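(* Let $A, B \in \mathbb{R}^{n\times n}$. The generalized absolute value equation $Ax + B|x| = b$ has a unique solution $x \in \mathbb{R}^n$ for every $b \in \mathbb{R}^{n}$ if and only if the matrix $A + B - 2BD$ is nonsingular for every diagonal matrix $D = \mathrm{diag}(d_{i}) \in \mathbb{R}^{n\times n}$ with $0 \leq d_{i} \leq 1$ for all $i$.
   Context: For $x \in \mathbb{R}^n$, $|x|$ denotes the componentwise absolute value of $x$. *)

theory Defs
  imports "HOL-Analysis.Analysis"
begin

definition diag :: "real ^ 'n \<Rightarrow> real ^ 'n ^ 'n" where
  "diag d = (\<chi> i j. if i = j then d $ i else 0)"

end

theory Submission
  imports Defs
begin

text \<open>
  Write \<open>F x = A x + B \<bar>x\<bar>\<close>. Componentwise, the difference quotients of the absolute value over an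
  increment \<open>z \<noteq> 0\<close> are exactly the numbers \<open>1 - 2 d\<close> with \<open>0 \<le> d \<le> 1\<close>. So the differences
  \<open>F x - F y\<close> with \<open>x - y = z\<close> are exactly the vectors \<open>(A + B - 2 B D) z\<close>, and \<open>F\<close> is
  injective iff all these matrices are nonsingular. An injective \<open>F\<close> is also surjective: by invariance
  of domain the image of the unit ball is a neighbourhood of \<open>F 0 = 0\<close>, and \<open>F\<close> is positively
  homogeneous.
\<close>

lemma surj_if_inj_pos_homogeneous:
  fixes f :: "'a::euclidean_space \<Rightarrow> 'a"
  assumes "continuous_on UNIV f" and "inj f"
    and hom: "\<And>c x. 0 \<le> c \<Longrightarrow> f (c *\<^sub>R x) = c *\<^sub>R f x"
  shows "surj f"
proof -
  have "open (f ` ball 0 1)"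
    using assms by (intro invariance_of_domain) (auto intro: continuous_on_subset inj_on_subset)
  moreover have "f 0 = 0"
    using hom[of 0 0] by simp
  then have "0 \<in> f ` ball 0 1"
    by (metis centre_in_ball imageI zero_less_one)
  ultimately obtain e where e: "e > 0" "cball 0 e \<subseteq> f ` ball 0 1"
    by (meson open_contains_cball)
  have "y \<in> range f" for y
  proof (cases "y = 0")
    case True
    then show ?thesis
      using \<open>f 0 = 0\<close> by (metis rangeI)
  next
    case False
    \<comment> \<open>Rescaled to norm \<open>e\<close>, \<open>y\<close> lies in the ball covered
      by the image; homogeneity then undoes the scaling on the preimage.\<close>
    have "(e / norm y) *\<^sub>R y \<in> cball 0 e"
      using e False by simp
    then obtain x where x: "f x = (e / norm y) *\<^sub>R y"
      using e by (metis imageE subsetD)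
    have "f ((norm y / e) *\<^sub>R x) = y"
      using e False by (simp add: hom x)
    then show ?thesis
      by (metis rangeI)
  qed
  then show ?thesis
    by auto
qed

text \<open>The reverse triangle inequality bounds the difference quotient \<open>q\<close> by 1 in
  absolute value, and \<open>d = (1 - q) / 2\<close> solves \<open>1 - 2 * d = q\<close>.\<close>

lemma abs_diff_slope:
  fixes a b :: real
  obtains d where "0 \<le> d" "d \<le> 1" "\<bar>a\<bar> - \<bar>b\<bar> = (1 - 2 * d) * (a - b)"
proof (cases "a = b")
  case True
  then show ?thesis
    by (intro that[of 0]) auto
next
  case False
  define q where "q = (\<bar>a\<bar> - \<bar>b\<bar>) / (a - b)"
  have "\<bar>q\<bar> \<le> 1"
    using False abs_triangle_ineq3[of a b] by (simp add: q_def abs_divide)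
  moreover have "\<bar>a\<bar> - \<bar>b\<bar> = q * (a - b)"
    using False by (simp add: q_def)
  moreover have "1 - 2 * ((1 - q) / 2) = q"
    by (simp add: field_simps)
  ultimately show ?thesis
    by (intro that[of "(1 - q) / 2"]) (simp_all only: abs_le_iff, simp_all)
qed

text \<open>Place an interval of length \<open>\<bar>z\<bar>\<close> around 0 so that the fraction
  \<open>d\<close> of it lies on the negative side. Its endpoints are \<open>a\<close> and
  \<open>b\<close>, with \<open>a\<close> on the right if \<open>z \<ge> 0\<close> and on the left
  otherwise.\<close>

lemma abs_diff_slope_attained:
  fixes z d :: real
  assumes "0 \<le> d" "d \<le> 1"
  obtains a b where "a - b = z" "\<bar>a\<bar> - \<bar>b\<bar> = (1 - 2 * d) * z"
proof (cases "z \<ge> 0")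
  case True
  then show ?thesis
    using assms by (intro that[of "(1 - d) * z" "- (d * z)"])
      (simp_all only: abs_mult abs_minus_cancel, auto simp: algebra_simps)
next
  case False
  then show ?thesis
    using assms by (intro that[of "d * z" "- ((1 - d) * z)"])
      (simp_all only: abs_mult abs_minus_cancel, auto simp: algebra_simps)
qed

lemma diag_mult_vec: "diag d *v x = (\<chi> i. d $ i * x $ i)"
  by (simp add: diag_def matrix_vector_mult_def vec_eq_iff if_distrib[where f = "\<lambda>c. c * _"]
      cong: if_cong)

lemma abs_vec_nth: "\<bar>x\<bar> $ i = \<bar>x $ i\<bar>" for x :: "real ^ 'n"
  by (simp add: abs_vec_def)

text \<open>The coordinatewise slopes combine into
  \<open>\<bar>x\<bar> - \<bar>y\<bar> = (I - 2 D) (x - y)\<close> with \<open>D = diag d\<close>;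
  multiplying by \<open>B\<close> gives the matrix.\<close>

lemma gave_diff:
  fixes A B :: "real ^ 'n ^ 'n"
  assumes "\<And>i. \<bar>x $ i\<bar> - \<bar>y $ i\<bar> = (1 - 2 * d $ i) * (x $ i - y $ i)"
  shows "(A *v x + B *v \<bar>x\<bar>) - (A *v y + B *v \<bar>y\<bar>) =
    (A + B - 2 *\<^sub>R (B ** diag d)) *v (x - y)"
proof -
  have "\<bar>x\<bar> - \<bar>y\<bar> = (x - y) - 2 *\<^sub>R (diag d *v (x - y))"
    using assms by (simp add: vec_eq_iff abs_vec_nth diag_mult_vec algebra_simps)
  then have "B *v \<bar>x\<bar> - B *v \<bar>y\<bar> = B *v ((x - y) - 2 *\<^sub>R (diag d *v (x - y)))"
    by (metis matrix_vector_mult_diff_distrib)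
  also have "\<dots> = (B - 2 *\<^sub>R (B ** diag d)) *v (x - y)"
    by (simp only: matrix_vector_mult_diff_distrib[of B "x - y"] matrix_vector_mult_scaleR
        matrix_vector_mul_assoc matrix_vector_mult_diff_rdistrib[of B]
        flip: scaleR_matrix_vector_assoc)
  finally show ?thesis
    by (simp add: algebra_simps)
qed

lemma gave_inj_iff:
  fixes A B :: "real ^ 'n ^ 'n"
  shows "inj (\<lambda>x. A *v x + B *v \<bar>x\<bar>) \<longleftrightarrow>
    (\<forall>d :: real ^ 'n. (\<forall>i. 0 \<le> d $ i \<and> d $ i \<le> 1) \<longrightarrow>
      invertible (A + B - 2 *\<^sub>R (B ** diag d)))" (is "inj ?F \<longleftrightarrow> (\<forall>d. ?I d \<longrightarrow> invertible (?M d))")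
proof
  assume inj: "inj ?F"
  show "\<forall>d. ?I d \<longrightarrow> invertible (?M d)"
  proof (intro allI impI)
    fix d :: "real ^ 'n"
    assume d: "?I d"
    have "z = 0" if z: "?M d *v z = 0" for z
    proof -
      \<comment> \<open>A kernel vector \<open>z\<close> becomes a collision of \<open>?F\<close>:
        each slope is attained in its own coordinate, independently of the others.\<close>
      have "\<exists>a b. a - b = z $ i \<and> \<bar>a\<bar> - \<bar>b\<bar> = (1 - 2 * d $ i) * z $ i" for i
        using d by (meson abs_diff_slope_attained)
      then obtain a b where
        ab: "\<And>i. a i - b i = z $ i" "\<And>i. \<bar>a i\<bar> - \<bar>b i\<bar> = (1 - 2 * d $ i) * z $ i"
        by metis
      define x y :: "real ^ 'n" where "x = vec_lambda a" and "y = vec_lambda b"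
      have xy: "x - y = z"
        using ab by (simp add: x_def y_def vec_eq_iff)
      have "?F x - ?F y = ?M d *v (x - y)"
        by (rule gave_diff) (simp add: x_def y_def ab)
      then have "?F x = ?F y"
        using xy z by simp
      then have "x = y"
        by (rule injD[OF inj])
      then show "z = 0"
        using xy by simp
    qed
    then show "invertible (?M d)"
      unfolding invertible_left_inverse matrix_left_invertible_ker by blast
  qed
next
  assume inv: "\<forall>d. ?I d \<longrightarrow> invertible (?M d)"
  show "inj ?F"
  proof (rule injI)
    fix x y :: "real ^ 'n"
    assume eq: "?F x = ?F y"
    \<comment> \<open>The diagonal is chosen to fit this particular pair \<open>x\<close>,
      \<open>y\<close>, so the hypothesis is needed for all admissible \<open>d\<close>.\<close>
    have "\<exists>d. 0 \<le> d \<and> d \<le> 1 \<and> \<bar>x $ i\<bar> - \<bar>y $ i\<bar> = (1 - 2 * d) * (x $ i - y $ i)" for i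
      by (meson abs_diff_slope)
    then obtain d where d: "\<And>i. 0 \<le> d i \<and> d i \<le> 1"
        "\<And>i. \<bar>x $ i\<bar> - \<bar>y $ i\<bar> = (1 - 2 * d i) * (x $ i - y $ i)"
      by metis
    have "?F x - ?F y = ?M (vec_lambda d) *v (x - y)"
      by (rule gave_diff) (simp add: d)
    then have "?M (vec_lambda d) *v (x - y) = 0"
      using eq by simp
    moreover have "invertible (?M (vec_lambda d))"
      using inv d by simp
    ultimately have "x - y = 0"
      unfolding invertible_left_inverse matrix_left_invertible_ker by blast
    then show "x = y"
      by simp
  qed
qed

lemma gave_surj_if_inj:
  fixes A B :: "real ^ 'n ^ 'n"
  assumes "inj (\<lambda>x. A *v x + B *v \<bar>x\<bar>)"
  shows "surj (\<lambda>x. A *v x + B *v \<bar>x\<bar>)"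
proof (rule surj_if_inj_pos_homogeneous)
  have "continuous_on UNIV (\<lambda>x :: real ^ 'n. \<bar>x\<bar>)"
    unfolding abs_vec_def by (intro continuous_intros)
  then show "continuous_on UNIV (\<lambda>x. A *v x + B *v \<bar>x\<bar>)"
    by (intro continuous_on_add continuous_on_compose2[OF matrix_vector_mult_linear_continuous_on]) auto
  show "A *v (c *\<^sub>R x) + B *v \<bar>c *\<^sub>R x\<bar> = c *\<^sub>R (A *v x + B *v \<bar>x\<bar>)"
    if "0 \<le> c" for c x
  proof -
    \<comment> \<open>Only nonnegative factors pass through the absolute value.\<close>
    have "\<bar>c *\<^sub>R x\<bar> = c *\<^sub>R \<bar>x\<bar>"
      using that by (simp add: vec_eq_iff abs_vec_nth abs_mult)
    then show ?thesis
      by (simp add: matrix_vector_mult_scaleR scaleR_right_distrib)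
  qed
qed (rule assms)

theorem corollary3p2:
  fixes A B :: "real ^ 'n ^ 'n"
  shows "(\<forall>b :: real ^ 'n. \<exists>!x :: real ^ 'n. A *v x + B *v \<bar>x\<bar> = b) \<longleftrightarrow>
    (\<forall>d :: real ^ 'n. (\<forall>i. 0 \<le> d $ i \<and> d $ i \<le> 1) \<longrightarrow>
      invertible (A + B - 2 *\<^sub>R (B ** diag d)))"
proof -
  have "(\<forall>b. \<exists>!x. A *v x + B *v \<bar>x\<bar> = b) \<longleftrightarrow> bij (\<lambda>x. A *v x + B *v \<bar>x\<bar>)"
    by (simp only: bij_iff)
  \<comment> \<open>Existence of solutions follows from their uniqueness.\<close>
  also have "\<dots> \<longleftrightarrow> inj (\<lambda>x. A *v x + B *v \<bar>x\<bar>)"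
    using gave_surj_if_inj bij_def by blast
  finally show ?thesis
    by (simp only: gave_inj_iff)
qed

end
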